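(* Let $k$ be any fixed positive integer, let $(b_i)_{0\le i\le k}$ be a log-concave sequence of nonnegative real numbers, and let $\binom{n,k}{j}$ be defined by $$(b_0+b_1x+\cdots+b_kx^{k})^n=\sum_{j=0}^{kn}\binom{n,k}{j}x^j .$$ Then the linear transformation $$y_n=\sum_{i=0}^{kn}\binom{n,k}{i}x_i\qquad (n\ge 0)$$ preserves both the log-concavity property and the log-convexity property; that is, if the sequence $(x_i)_{i\ge 0}$ of nonnegative real numbers is log-concave, then $(y_n)_{n\ge 0}$ is log-concave, and if $(x_i)_{i\ge 0}$ is log-convex, then $(y_n)_{n\ge 0}$ is log-convex.
   Context: A sequence $(a_n)$ of nonnegative real numbers is log-concave if $a_{n-1}a_{n+1}\le a_n^2$ for all $n\ge 1$ for which the terms are defined, and log-convex if $a_{n-1}a_{n+1}\ge a_n^2$ for all such $n$. It has no internal zeros if $a_j\ne 0$ whenever $i<j<l$ and $a_ia_l\neq 0$. Throughout, all sequences (including $(b_i)$ and $(x_i)$) are assumed to have no internal zeros. *)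

theory Defs
  imports Complex_Main "HOL-Computational_Algebra.Polynomial"
begin

text \<open>
  A sequence is a function on \<^typ>\<open>nat\<close> together with the set \<open>I\<close> of indices at which its terms
  are defined: \<open>{0..k}\<close> for a finite sequence, \<open>UNIV\<close> for an infinite one. Values outside \<open>I\<close>
  are irrelevant. Log-concavity and log-convexity are notions for nonnegative sequences.
\<close>

definition nonneg_on :: "nat set \<Rightarrow> (nat \<Rightarrow> real) \<Rightarrow> bool" where
  "nonneg_on I a \<longleftrightarrow> (\<forall>n\<in>I. 0 \<le> a n)"

definition log_concave_on :: "nat set \<Rightarrow> (nat \<Rightarrow> real) \<Rightarrow> bool" where
  "log_concave_on I a \<longleftrightarrow> nonneg_on I a \<and>
     (\<forall>n\<ge>1. n - 1 \<in> I \<and> n \<in> I \<and> n + 1 \<in> I \<longrightarrow> a (n - 1) * a (n + 1) \<le> (a n)\<^sup>2)"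

definition log_convex_on :: "nat set \<Rightarrow> (nat \<Rightarrow> real) \<Rightarrow> bool" where
  "log_convex_on I a \<longleftrightarrow> nonneg_on I a \<and>
     (\<forall>n\<ge>1. n - 1 \<in> I \<and> n \<in> I \<and> n + 1 \<in> I \<longrightarrow> a (n - 1) * a (n + 1) \<ge> (a n)\<^sup>2)"

definition no_internal_zeros_on :: "nat set \<Rightarrow> (nat \<Rightarrow> real) \<Rightarrow> bool" where
  "no_internal_zeros_on I a \<longleftrightarrow>
     (\<forall>i\<in>I. \<forall>j\<in>I. \<forall>l\<in>I. i < j \<and> j < l \<and> a i * a l \<noteq> 0 \<longrightarrow> a j \<noteq> 0)"

definition gen_binomial :: "(nat \<Rightarrow> real) \<Rightarrow> nat \<Rightarrow> nat \<Rightarrow> nat \<Rightarrow> real" where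
  "gen_binomial b k n j = coeff ((\<Sum>i=0..k. monom (b i) i) ^ n) j"

definition gen_binomial_transform ::
    "(nat \<Rightarrow> real) \<Rightarrow> nat \<Rightarrow> (nat \<Rightarrow> real) \<Rightarrow> nat \<Rightarrow> real" where
  "gen_binomial_transform b k x n = (\<Sum>i=0..k * n. gen_binomial b k n i * x i)"

end

theory Submission
  imports Defs
begin

text \<open>
  Let \<open>T\<close> be the operator \<open>(T z) m = (\<Sum>t\<le>k. b t * z (m + t))\<close>, so that \<open>y n = (T ^^ n) x 0\<close>.
  \<open>T\<close> preserves log-concavity (a symmetrised Cauchy--Binet identity) and log-convexity (sums of
  log-convex sequences are log-convex). With \<open>z = (T ^^ n) x\<close> the claim therefore reduces to
  comparing \<open>z 0 * (T (T z)) 0 = (\<Sum>s t. b s * b t * (z 0 * z (s + t)))\<close> with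
  \<open>((T z) 0)\<^sup>2 = (\<Sum>s t. b s * b t * (z s * z t))\<close>, which can be done term by term.
  In the log-concave case, \<open>z 0 \<noteq> 0\<close> and \<open>(T z) 0 = 0\<close> force \<open>T z = 0\<close>, so \<open>y\<close> has no internal
  zeros.
\<close>

section \<open>Log-concave and log-convex sequences on all of \<open>nat\<close>\<close>

lemma all_ge_1_iff_all_Suc: "(\<forall>n\<ge>1. P n) \<longleftrightarrow> (\<forall>n. P (Suc n))"
  by (auto simp: Suc_le_eq gr0_conv_Suc)

lemma log_concave_UNIV_iff:
  "log_concave_on UNIV a \<longleftrightarrow> (\<forall>n. 0 \<le> a n) \<and> (\<forall>n. a n * a (n + 2) \<le> (a (n + 1))\<^sup>2)"
  unfolding log_concave_on_def nonneg_on_def all_ge_1_iff_all_Suc by simp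

lemma log_convex_UNIV_iff:
  "log_convex_on UNIV a \<longleftrightarrow> (\<forall>n. 0 \<le> a n) \<and> (\<forall>n. (a (n + 1))\<^sup>2 \<le> a n * a (n + 2))"
  unfolding log_convex_on_def nonneg_on_def all_ge_1_iff_all_Suc by simp

lemma no_internal_zeros_UNIV_D:
  assumes "no_internal_zeros_on UNIV a" "a j = 0" "i \<le> j" "j \<le> l"
  shows "a i * a l = 0"
proof (cases "i = j \<or> j = l")
  case False
  then have "i < j" "j < l"
    using assms by auto
  then show ?thesis
    using assms unfolding no_internal_zeros_on_def by blast
qed (use assms in auto)

text \<open>The ratios \<open>a (j + 1) / a j\<close> decrease; cross-multiplying avoids division by
  zero. If \<open>a j = 0\<close> in the induction step, the absence of internal zeros kills the
  left-hand side; otherwise \<open>a j\<close> cancels.\<close>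

lemma log_concave_cross:
  assumes lc: "log_concave_on UNIV a" and nz: "no_internal_zeros_on UNIV a" and "i \<le> j"
  shows "a i * a (j + 1) \<le> a (i + 1) * a j"
  using \<open>i \<le> j\<close>
proof (induction j rule: dec_induct)
  case base
  show ?case
    by (simp add: mult.commute)
next
  case (step j)
  have nonneg: "0 \<le> a n" and lc': "a n * a (n + 2) \<le> (a (n + 1))\<^sup>2" for n
    using lc by (auto simp: log_concave_UNIV_iff)
  show ?case
  proof (cases "a j = 0")
    case True
    then have "a i * a (Suc j + 1) = 0"
      using no_internal_zeros_UNIV_D[OF nz True, of i "Suc j + 1"] step.hyps by simp
    also have "0 \<le> a (i + 1) * a (Suc j)"
      by (simp add: nonneg)
    finally show ?thesis .
  next
    case False
    then have pos: "0 < a j"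
      using nonneg[of j] by simp
    have "(a i * a (j + 2)) * a j \<le> a i * (a (j + 1))\<^sup>2"
      using mult_left_mono[OF lc'[of j] nonneg[of i]] by (simp add: mult_ac)
    also have "\<dots> \<le> (a (i + 1) * a (j + 1)) * a j"
      using mult_right_mono[OF step.IH nonneg[of "j + 1"]] by (simp add: power2_eq_square mult_ac)
    finally show ?thesis
      using pos by simp
  qed
qed

text \<open>Increasing ratios, cross-multiplied. Here a zero \<open>a j\<close> forces
  \<open>a (j + 1) = 0\<close> by log-convexity, so the left-hand side vanishes.\<close>

lemma log_convex_cross:
  assumes lc: "log_convex_on UNIV a" and "i \<le> j"
  shows "a (i + 1) * a j \<le> a i * a (j + 1)"
  using \<open>i \<le> j\<close>
proof (induction j rule: dec_induct)
  case base
  show ?case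
    by (simp add: mult.commute)
next
  case (step j)
  have nonneg: "0 \<le> a n" and lc': "(a (n + 1))\<^sup>2 \<le> a n * a (n + 2)" for n
    using lc by (auto simp: log_convex_UNIV_iff)
  show ?case
  proof (cases "a j = 0")
    case True
    then have "a (j + 1) = 0"
      using lc'[of j] by simp
    then show ?thesis
      using nonneg by simp
  next
    case False
    then have pos: "0 < a j"
      using nonneg[of j] by simp
    have "(a (i + 1) * a (j + 1)) * a j \<le> a i * (a (j + 1))\<^sup>2"
      using mult_right_mono[OF step.IH nonneg[of "j + 1"]] by (simp add: power2_eq_square mult_ac)
    also have "\<dots> \<le> (a i * a (j + 2)) * a j"
      using mult_left_mono[OF lc'[of j] nonneg[of i]] by (simp add: mult_ac)
    finally show ?thesis
      using pos by simp
  qed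
qed

text \<open>Telescoping in \<open>i\<close>: the ratio at \<open>i + j\<close> is at most the ratio
  at \<open>i\<close>, so each step multiplies the induction hypothesis by a cross inequality and
  cancels \<open>a i\<close>.\<close>

lemma log_concave_submult:
  assumes lc: "log_concave_on UNIV a" and nz: "no_internal_zeros_on UNIV a"
  shows "a 0 * a (i + j) \<le> a i * a j"
proof (induction i)
  case (Suc i)
  have nonneg: "0 \<le> a n" for n
    using lc by (auto simp: log_concave_UNIV_iff)
  show ?case
  proof (cases "a i = 0")
    case True
    then have "a 0 * a (Suc i + j) = 0"
      using no_internal_zeros_UNIV_D[OF nz True, of 0 "Suc i + j"] by simp
    also have "0 \<le> a (Suc i) * a j"
      by (simp add: nonneg)
    finally show ?thesis .
  next
    case False
    then have pos: "0 < a i"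
      using nonneg[of i] by simp
    have "(a 0 * a (Suc i + j)) * a i \<le> a (i + 1) * (a 0 * a (i + j))"
      using mult_left_mono[OF log_concave_cross[OF lc nz, of i "i + j"] nonneg[of 0]]
      by (simp add: mult_ac)
    also have "\<dots> \<le> (a (Suc i) * a j) * a i"
      using mult_left_mono[OF Suc.IH nonneg[of "i + 1"]] by (simp add: mult_ac)
    finally show ?thesis
      using pos by simp
  qed
qed simp

lemma log_convex_supermult:
  assumes lc: "log_convex_on UNIV a"
  shows "a i * a j \<le> a 0 * a (i + j)"
proof (induction i)
  case (Suc i)
  have nonneg: "0 \<le> a n" and lc': "(a (n + 1))\<^sup>2 \<le> a n * a (n + 2)" for n
    using lc by (auto simp: log_convex_UNIV_iff)
  show ?case
  proof (cases "a i = 0")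
    case True
    then have "a (Suc i) = 0"
      using lc'[of i] by simp
    then show ?thesis
      using nonneg by simp
  next
    case False
    then have pos: "0 < a i"
      using nonneg[of i] by simp
    have "(a (Suc i) * a j) * a i \<le> a (i + 1) * (a 0 * a (i + j))"
      using mult_left_mono[OF Suc.IH nonneg[of "i + 1"]] by (simp add: mult_ac)
    also have "\<dots> \<le> (a 0 * a (Suc i + j)) * a i"
      using mult_left_mono[OF log_convex_cross[OF lc, of i "i + j"] nonneg[of 0]]
      by (simp add: mult_ac)
    finally show ?thesis
      using pos by simp
  qed
qed simp

text \<open>A zero propagates to every later index, so no nonzero term can follow it.\<close>

lemma log_convex_imp_no_internal_zeros:
  assumes lc: "log_convex_on UNIV a"
  shows "no_internal_zeros_on UNIV a"
proof -
  have "a l = 0" if "j \<le> l" "a j = 0" for j l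
    using that
  proof (induction l rule: dec_induct)
    case (step n)
    have "(a (n + 1))\<^sup>2 \<le> a n * a (n + 2)"
      using lc by (simp add: log_convex_UNIV_iff)
    with step show ?case
      by simp
  qed
  then show ?thesis
    unfolding no_internal_zeros_on_def by (metis less_imp_le mult_zero_right)
qed

section \<open>The operator \<open>T\<close> and its powers\<close>

definition weighted_shift :: "(nat \<Rightarrow> real) \<Rightarrow> nat \<Rightarrow> (nat \<Rightarrow> real) \<Rightarrow> nat \<Rightarrow> real" where
  "weighted_shift b k z m = (\<Sum>t\<le>k. b t * z (m + t))"

lemma degree_sum_monom_power_le:
  "degree ((\<Sum>i=0..k. monom (b i) i) ^ n) \<le> k * n"
proof -
  have "degree (monom (b i) i) \<le> k" if "i \<le> k" for i
    using degree_monom_le that by (rule order.trans)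
  then have "degree (\<Sum>i=0..k. monom (b i) i) \<le> k"
    by (intro degree_sum_le) auto
  then show ?thesis
    by (intro order.trans[OF degree_power_le] mult_le_mono1)
qed

lemma gen_binomial_eq_0: "k * n < j \<Longrightarrow> gen_binomial b k n j = 0"
  unfolding gen_binomial_def
  by (intro coeff_eq_0 le_less_trans[OF degree_sum_monom_power_le])

lemma gen_binomial_Suc:
  "gen_binomial b k (Suc n) i = (\<Sum>t\<le>k. if i < t then 0 else b t * gen_binomial b k n (i - t))"
  by (auto simp: gen_binomial_def sum_distrib_right coeff_sum coeff_monom_mult atLeast0AtMost
      intro!: sum.cong)

text \<open>\<open>T\<close> is the polynomial with coefficients \<open>b\<close> evaluated at the
  shift \<open>z \<mapsto> (\<lambda>m. z (m + 1))\<close>, so its powers carry the coefficients of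
  the powers of that polynomial.\<close>

lemma funpow_weighted_shift:
  "(weighted_shift b k ^^ n) x m = (\<Sum>i\<le>k * n. gen_binomial b k n i * x (m + i))"
proof (induction n arbitrary: m)
  case 0
  show ?case
    by (simp add: gen_binomial_def)
next
  case (Suc n)
  have shift: "(\<Sum>i\<le>k * Suc n. (if i < t then 0 else b t * gen_binomial b k n (i - t)) * x (m + i))
      = b t * (\<Sum>j\<le>k * n. gen_binomial b k n j * x (m + t + j))" if "t \<le> k" for t
  proof -
    let ?g = "\<lambda>i. (if i < t then 0 else b t * gen_binomial b k n (i - t)) * x (m + i)"
    \<comment> \<open>Below \<open>t\<close> the conditional gives 0, above \<open>k * n + t\<close>
      the degree bound does; \<open>t \<le> k\<close> keeps the window inside the range.\<close>
    have "sum ?g {..k * Suc n} = sum ?g {t..k * n + t}"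
      using that by (intro sum.mono_neutral_right) (auto simp: gen_binomial_eq_0 not_le)
    also have "\<dots> = (\<Sum>j\<le>k * n. b t * gen_binomial b k n j * x (m + t + j))"
      by (rule sum.reindex_bij_witness[where i = "\<lambda>j. j + t" and j = "\<lambda>i. i - t"])
        (auto simp: ac_simps)
    finally show ?thesis
      by (simp add: sum_distrib_left mult.assoc)
  qed
  have "(weighted_shift b k ^^ Suc n) x m
      = (\<Sum>t\<le>k. b t * (\<Sum>j\<le>k * n. gen_binomial b k n j * x (m + t + j)))"
    by (simp add: weighted_shift_def Suc.IH)
  also have "\<dots> = (\<Sum>t\<le>k. \<Sum>i\<le>k * Suc n.
      (if i < t then 0 else b t * gen_binomial b k n (i - t)) * x (m + i))"
    by (intro sum.cong refl) (simp add: shift del: mult_Suc_right)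
  also have "\<dots> = (\<Sum>i\<le>k * Suc n. gen_binomial b k (Suc n) i * x (m + i))"
    by (subst sum.swap) (simp add: gen_binomial_Suc sum_distrib_right del: mult_Suc_right)
  finally show ?case .
qed

lemma gen_binomial_transform_eq_funpow:
  "gen_binomial_transform b k x n = (weighted_shift b k ^^ n) x 0"
  by (simp add: funpow_weighted_shift gen_binomial_transform_def atLeast0AtMost)

section \<open>The inequalities between \<open>z 0\<close>, \<open>(T z) 0\<close> and
  \<open>(T (T z)) 0\<close>\<close>

lemma weighted_shift_nonneg:
  assumes "\<And>t. t \<le> k \<Longrightarrow> 0 \<le> b t" "\<And>n. 0 \<le> z n"
  shows "0 \<le> weighted_shift b k z m"
  unfolding weighted_shift_def using assms by (intro sum_nonneg mult_nonneg_nonneg) auto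

lemma weighted_shift_twice:
  "weighted_shift b k (weighted_shift b k z) 0 = (\<Sum>s\<le>k. \<Sum>t\<le>k. b s * b t * z (s + t))"
  by (simp add: weighted_shift_def sum_distrib_left mult.assoc)

lemma weighted_shift_mult:
  "weighted_shift b k z m * weighted_shift c l w n
    = (\<Sum>s\<le>k. \<Sum>t\<le>l. b s * c t * (z (m + s) * w (n + t)))"
  by (simp add: weighted_shift_def sum_product mult_ac)

lemma weighted_shift_turan_log_concave:
  assumes b: "\<And>t. t \<le> k \<Longrightarrow> 0 \<le> b t"
    and z: "log_concave_on UNIV z" "no_internal_zeros_on UNIV z"
  shows "z 0 * weighted_shift b k (weighted_shift b k z) 0 \<le> (weighted_shift b k z 0)\<^sup>2"
proof -
  have "z 0 * weighted_shift b k (weighted_shift b k z) 0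
      = (\<Sum>s\<le>k. \<Sum>t\<le>k. b s * b t * (z 0 * z (s + t)))"
    by (simp add: weighted_shift_twice sum_distrib_left mult_ac)
  also have "\<dots> \<le> (\<Sum>s\<le>k. \<Sum>t\<le>k. b s * b t * (z s * z t))"
    using b by (intro sum_mono mult_left_mono log_concave_submult z) auto
  finally show ?thesis
    by (simp add: power2_eq_square weighted_shift_mult)
qed

lemma weighted_shift_turan_log_convex:
  assumes b: "\<And>t. t \<le> k \<Longrightarrow> 0 \<le> b t" and z: "log_convex_on UNIV z"
  shows "(weighted_shift b k z 0)\<^sup>2 \<le> z 0 * weighted_shift b k (weighted_shift b k z) 0"
proof -
  have "(weighted_shift b k z 0)\<^sup>2 = (\<Sum>s\<le>k. \<Sum>t\<le>k. b s * b t * (z s * z t))"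
    by (simp add: power2_eq_square weighted_shift_mult)
  also have "\<dots> \<le> (\<Sum>s\<le>k. \<Sum>t\<le>k. b s * b t * (z 0 * z (s + t)))"
    using b by (intro sum_mono mult_left_mono log_convex_supermult z) auto
  also have "\<dots> = z 0 * weighted_shift b k (weighted_shift b k z) 0"
    by (simp add: weighted_shift_twice sum_distrib_left mult_ac)
  finally show ?thesis .
qed

section \<open>\<open>T\<close> preserves log-convexity\<close>

lemma weighted_shift_log_convex:
  assumes b: "\<And>t. t \<le> k \<Longrightarrow> 0 \<le> b t" and z: "log_convex_on UNIV z"
  shows "log_convex_on UNIV (weighted_shift b k z)"
proof -
  let ?w = "weighted_shift b k z"
  have nonneg: "0 \<le> z n" and lc: "(z (n + 1))\<^sup>2 \<le> z n * z (n + 2)" for n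
    using z by (auto simp: log_convex_UNIV_iff)
  \<comment> \<open>AM-GM for \<open>p = z i * z (j + 2)\<close> and
    \<open>q = z j * z (i + 2)\<close>: regrouping \<open>p * q\<close> by index and using
    log-convexity at \<open>i\<close> and at \<open>j\<close> bounds it below by the square of
    \<open>z (i + 1) * z (j + 1)\<close>.\<close>
  have amgm: "2 * (z (i + 1) * z (j + 1)) \<le> z i * z (j + 2) + z j * z (i + 2)" for i j
  proof (rule power2_le_imp_le)
    have "(2 * (z (i + 1) * z (j + 1)))\<^sup>2 = 4 * ((z (i + 1))\<^sup>2 * (z (j + 1))\<^sup>2)"
      by (simp add: power_mult_distrib)
    also have "\<dots> \<le> 4 * ((z i * z (i + 2)) * (z j * z (j + 2)))"
      by (intro mult_left_mono mult_mono lc) (simp_all add: nonneg)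
    also have "\<dots> = 4 * (z i * z (j + 2)) * (z j * z (i + 2))"
      by (simp add: mult_ac)
    also have "\<dots> \<le> (z i * z (j + 2) + z j * z (i + 2))\<^sup>2"
      using zero_le_power2[of "z i * z (j + 2) - z j * z (i + 2)"]
      by (simp add: power2_eq_square algebra_simps)
    finally show "(2 * (z (i + 1) * z (j + 1)))\<^sup>2 \<le> (z i * z (j + 2) + z j * z (i + 2))\<^sup>2" .
  qed (simp add: nonneg)
  have "(?w (m + 1))\<^sup>2 \<le> ?w m * ?w (m + 2)" for m
  proof -
    \<comment> \<open>Adding this copy, with \<open>s\<close> and \<open>t\<close> exchanged, to the
      direct expansion symmetrises the double sum, so that \<open>amgm\<close> applies term by
      term.\<close>
    have swap: "?w m * ?w (m + 2) = (\<Sum>s\<le>k. \<Sum>t\<le>k. b s * b t * (z (m + t) * z (m + 2 + s)))"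
      by (subst weighted_shift_mult, subst sum.swap) (simp add: mult_ac)
    have "2 * (?w (m + 1))\<^sup>2
        = (\<Sum>s\<le>k. \<Sum>t\<le>k. b s * b t * (2 * (z (m + s + 1) * z (m + t + 1))))"
      by (simp add: power2_eq_square weighted_shift_mult sum_distrib_left mult_ac)
    also have "\<dots> \<le> (\<Sum>s\<le>k. \<Sum>t\<le>k.
        b s * b t * (z (m + s) * z (m + t + 2) + z (m + t) * z (m + s + 2)))"
      using b by (intro sum_mono mult_left_mono amgm) auto
    also have "\<dots> = ?w m * ?w (m + 2) + ?w m * ?w (m + 2)"
      by (subst (2) swap) (simp add: weighted_shift_mult distrib_left sum.distrib ac_simps)
    finally show ?thesis
      by simp
  qed
  then show ?thesis
    using weighted_shift_nonneg[of k b z, OF b nonneg] by (simp add: log_convex_UNIV_iff)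
qed

section \<open>\<open>T\<close> preserves log-concavity\<close>

lemma cauchy_binet_le:
  fixes b c u v :: "nat \<Rightarrow> real"
  assumes cb: "\<And>i j. i \<le> j \<Longrightarrow> c i * b j \<le> c j * b i"
    and uv: "\<And>i j. i \<le> j \<Longrightarrow> u i * v j \<le> u j * v i"
  shows "(\<Sum>i\<le>n. c i * v i) * (\<Sum>i\<le>n. b i * u i) \<le> (\<Sum>i\<le>n. c i * u i) * (\<Sum>i\<le>n. b i * v i)"
    (is "?cv * ?bu \<le> ?cu * ?bv")
proof -
  \<comment> \<open>Both 2x2 minors are nonpositive for \<open>i \<le> j\<close> and change sign
    together when \<open>i\<close> and \<open>j\<close> are exchanged. Summing over all ordered
    pairs gives twice the difference of the two sides.\<close>
  have "0 \<le> (c i * b j - c j * b i) * (u i * v j - u j * v i)" for i j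
    using cb[of i j] cb[of j i] uv[of i j] uv[of j i]
    by (cases "i \<le> j") (auto intro: mult_nonneg_nonneg mult_nonpos_nonpos)
  then have "0 \<le> (\<Sum>i\<le>n. \<Sum>j\<le>n. (c i * b j - c j * b i) * (u i * v j - u j * v i))"
    by (intro sum_nonneg)
  also have "\<dots> = (\<Sum>i\<le>n. \<Sum>j\<le>n. (c i * u i) * (b j * v j) - (c i * v i) * (b j * u j)
      - (b i * u i) * (c j * v j) + (b i * v i) * (c j * u j))"
    by (intro sum.cong refl) (simp add: algebra_simps)
  also have "\<dots> = ?cu * ?bv - ?cv * ?bu - ?bu * ?cv + ?bv * ?cu"
    by (simp only: sum.distrib sum_subtractf sum_product)
  finally show ?thesis
    by (simp add: mult.commute)
qed

text \<open>Moving the shift from \<open>z\<close> onto the weights writes \<open>T z\<close> at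
  \<open>m\<close> and at \<open>m + 1\<close> over the same window of \<open>z\<close>, with
  weights \<open>b\<close> and shifted weights \<open>c\<close>. Applying this at \<open>m\<close>
  and at \<open>m + 1\<close> turns the claim into a Cauchy-Binet inequality.\<close>

lemma weighted_shift_log_concave:
  assumes b: "log_concave_on UNIV b" "no_internal_zeros_on UNIV b" and b0: "b (Suc k) = 0"
    and z: "log_concave_on UNIV z" "no_internal_zeros_on UNIV z"
  shows "log_concave_on UNIV (weighted_shift b k z)"
proof -
  let ?w = "weighted_shift b k z"
  \<comment> \<open>\<open>b\<close> moved right by one place. Its last weight sits at
    \<open>Suc k\<close>, and \<open>b (Suc k) = 0\<close> lets both sums run up to there.\<close>
  define c where "c i = (case i of 0 \<Rightarrow> 0 | Suc i \<Rightarrow> b i)" for i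
  have nonneg: "0 \<le> b n" "0 \<le> z n" for n
    using b z by (auto simp: log_concave_UNIV_iff)
  have cb: "c i * b j \<le> c j * b i" if "i \<le> j" for i j
    using that log_concave_cross[OF b, of "i - 1" "j - 1"] nonneg
    by (auto simp: c_def mult.commute split: nat.split)
  have w_b: "?w m = (\<Sum>i\<le>Suc k. b i * z (m + i))" for m
    by (simp add: weighted_shift_def b0)
  have w_c: "?w (m + 1) = (\<Sum>i\<le>Suc k. c i * z (m + i))" for m
    by (simp add: weighted_shift_def c_def sum.atMost_Suc_shift del: sum.atMost_Suc)
  have "?w m * ?w (m + 2) \<le> (?w (m + 1))\<^sup>2" for m
  proof -
    have "z (m + i) * z (m + 1 + j) \<le> z (m + j) * z (m + 1 + i)" if "i \<le> j" for i j
      using log_concave_cross[OF z, of "m + i" "m + j"] that by (simp add: ac_simps)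
    \<comment> \<open>Here \<open>u i = z (m + i)\<close> and \<open>v i = z (m + 1 + i)\<close>;
      the four sums are \<open>?w (m + 2)\<close>, \<open>?w m\<close> and twice
      \<open>?w (m + 1)\<close>.\<close>
    then have "(\<Sum>i\<le>Suc k. c i * z (m + 1 + i)) * (\<Sum>i\<le>Suc k. b i * z (m + i))
        \<le> (\<Sum>i\<le>Suc k. c i * z (m + i)) * (\<Sum>i\<le>Suc k. b i * z (m + 1 + i))"
      by (intro cauchy_binet_le cb)
    then have "?w (m + 1 + 1) * ?w m \<le> ?w (m + 1) * ?w (m + 1)"
      by (simp only: w_c[symmetric] w_b[symmetric])
    then show ?thesis
      by (simp add: power2_eq_square mult.commute)
  qed
  then show ?thesis
    using weighted_shift_nonneg[of k b z] nonneg by (simp add: log_concave_UNIV_iff)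
qed

section \<open>Zeros of \<open>T z\<close>\<close>

lemma weighted_shift_eq_0_iff:
  assumes "\<And>t. t \<le> k \<Longrightarrow> 0 \<le> b t" "\<And>n. 0 \<le> z n"
  shows "weighted_shift b k z m = 0 \<longleftrightarrow> (\<forall>t\<le>k. b t * z (m + t) = 0)"
  unfolding weighted_shift_def using assms by (subst sum_nonneg_eq_0_iff) auto

lemma weighted_shift_no_internal_zeros:
  assumes b: "\<And>t. 0 \<le> b t" "no_internal_zeros_on UNIV b"
    and z: "\<And>n. 0 \<le> z n" "no_internal_zeros_on UNIV z"
  shows "no_internal_zeros_on UNIV (weighted_shift b k z)"
  unfolding no_internal_zeros_on_def
proof (intro ballI impI)
  fix i j l
  assume "i < j \<and> j < l \<and> weighted_shift b k z i * weighted_shift b k z l \<noteq> 0"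
  then obtain t s where ij: "i < j" "j < l"
    and t: "t \<le> k" "b t \<noteq> 0" "z (i + t) \<noteq> 0" and s: "s \<le> k" "b s \<noteq> 0" "z (l + s) \<noteq> 0"
    by (auto simp: weighted_shift_eq_0_iff b z)
  have "\<exists>r\<le>k. b r \<noteq> 0 \<and> z (j + r) \<noteq> 0"
  \<comment> \<open>Either keep the weight index \<open>t\<close>, when \<open>j + t\<close> lies
    between \<open>i + t\<close> and \<open>l + s\<close>, or keep the position \<open>l + s\<close>
    in \<open>z\<close>; then the weight index \<open>l + s - j\<close> lies between
    \<open>s\<close> and \<open>t\<close>.\<close>
  proof (cases "j + t \<le> l + s")
    case True
    then have "z (j + t) \<noteq> 0"
      using no_internal_zeros_UNIV_D[OF z(2), of "j + t" "i + t" "l + s"] ij t s by auto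
    with t show ?thesis
      by blast
  next
    case False
    then have "s \<le> l + s - j" "l + s - j \<le> t"
      using ij by linarith+
    then have "b (l + s - j) \<noteq> 0"
      using no_internal_zeros_UNIV_D[OF b(2), of "l + s - j" s t] t s by auto
    with False ij t s show ?thesis
      by (intro exI[of _ "l + s - j"]) auto
  qed
  then show "weighted_shift b k z j \<noteq> 0"
    by (auto simp: weighted_shift_eq_0_iff b z)
qed

text \<open>Each \<open>b t * z t\<close> is zero. Where \<open>b t \<noteq> 0\<close>,
  \<open>z t = 0\<close> follows, and since \<open>z 0 \<noteq> 0\<close>, \<open>z\<close> must
  vanish from \<open>t\<close> onwards.\<close>

lemma weighted_shift_vanishes:
  assumes b: "\<And>t. t \<le> k \<Longrightarrow> 0 \<le> b t"
    and z: "\<And>n. 0 \<le> z n" "no_internal_zeros_on UNIV z"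
    and "z 0 \<noteq> 0" "weighted_shift b k z 0 = 0"
  shows "weighted_shift b k z = (\<lambda>_. 0)"
proof
  fix m
  have "b t * z (m + t) = 0" if "t \<le> k" for t
    using assms that no_internal_zeros_UNIV_D[OF z(2), of t 0 "m + t"]
    by (auto simp: weighted_shift_eq_0_iff b z)
  then show "weighted_shift b k z m = 0"
    unfolding weighted_shift_def by (intro sum.neutral) simp
qed

section \<open>Iterating \<open>T\<close>\<close>

lemma funpow_weighted_shift_log_concave:
  assumes b: "log_concave_on {0..k} b" "no_internal_zeros_on {0..k} b"
    and x: "log_concave_on UNIV x" "no_internal_zeros_on UNIV x"
  shows "log_concave_on UNIV ((weighted_shift b k ^^ n) x) \<and>
    no_internal_zeros_on UNIV ((weighted_shift b k ^^ n) x)"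
proof (induction n)
  case (Suc n)
  \<comment> \<open>Extension by zero makes the finite \<open>b\<close> an infinite sequence with
    \<open>b' (Suc k) = 0\<close>, without changing \<open>T\<close>. Log-concavity survives the
    cut, since a product with a term beyond \<open>k\<close> is 0.\<close>
  define b' where "b' i = (if i \<le> k then b i else 0)" for i
  have b_nonneg: "0 \<le> b i" if "i \<le> k" for i
    using b(1) that by (simp add: log_concave_on_def nonneg_on_def)
  have "b n * b (n + 2) \<le> (b (n + 1))\<^sup>2" if "n + 2 \<le> k" for n
    using b(1)[unfolded log_concave_on_def, THEN conjunct2, rule_format, of "n + 1"] that by simp
  then have b'_lc: "log_concave_on UNIV b'"
    by (auto simp: log_concave_UNIV_iff b'_def b_nonneg)
  have b'_nz: "no_internal_zeros_on UNIV b'"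
    unfolding no_internal_zeros_on_def
  proof (intro ballI impI)
    fix i j l
    assume ijl: "i < j \<and> j < l \<and> b' i * b' l \<noteq> 0"
    then have "l \<le> k" "b i * b l \<noteq> 0"
      by (auto simp: b'_def split: if_splits)
    with ijl show "b' j \<noteq> 0"
      using b(2)[unfolded no_internal_zeros_on_def, rule_format, of i j l] by (simp add: b'_def)
  qed
  have shift_b': "weighted_shift b k = weighted_shift b' k"
    by (auto simp: weighted_shift_def b'_def intro!: ext sum.cong)
  have nonneg: "0 \<le> b' m" "0 \<le> (weighted_shift b k ^^ n) x m" for m
    using Suc.IH b'_lc by (simp_all add: log_concave_UNIV_iff)
  have "log_concave_on UNIV (weighted_shift b' k ((weighted_shift b k ^^ n) x))"
    using Suc.IH by (intro weighted_shift_log_concave b'_lc b'_nz) (simp_all add: b'_def)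
  moreover have "no_internal_zeros_on UNIV (weighted_shift b' k ((weighted_shift b k ^^ n) x))"
    using Suc.IH by (intro weighted_shift_no_internal_zeros b'_nz nonneg) simp
  ultimately show ?case
    by (simp add: shift_b')
qed (use x in simp)

lemma funpow_weighted_shift_log_convex:
  assumes "\<And>t. t \<le> k \<Longrightarrow> 0 \<le> b t" "log_convex_on UNIV x"
  shows "log_convex_on UNIV ((weighted_shift b k ^^ n) x)"
  using assms by (induction n) (auto intro: weighted_shift_log_convex)

section \<open>The transformed sequence \<open>y\<close>\<close>

lemma gen_binomial_transform_log_concave:
  assumes b: "log_concave_on {0..k} b" "no_internal_zeros_on {0..k} b"
    and x: "log_concave_on UNIV x" "no_internal_zeros_on UNIV x"
  shows "log_concave_on UNIV (gen_binomial_transform b k x)"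
    and "no_internal_zeros_on UNIV (gen_binomial_transform b k x)"
proof -
  let ?z = "\<lambda>n. (weighted_shift b k ^^ n) x"
  let ?y = "gen_binomial_transform b k x"
  have b_nonneg: "0 \<le> b i" if "i \<le> k" for i
    using b(1) that by (simp add: log_concave_on_def nonneg_on_def)
  have z: "log_concave_on UNIV (?z n)" "no_internal_zeros_on UNIV (?z n)" for n
    using funpow_weighted_shift_log_concave[OF b x] by auto
  then have z_nonneg: "0 \<le> ?z n m" for n m
    by (simp add: log_concave_UNIV_iff)
  show "log_concave_on UNIV ?y"
    using weighted_shift_turan_log_concave[OF b_nonneg z] z_nonneg
    by (simp add: log_concave_UNIV_iff gen_binomial_transform_eq_funpow)
  \<comment> \<open>Once an iterate is the zero sequence, so are all later ones.\<close>
  have vanish: "?y m = 0" if "?y n \<noteq> 0" "?y (Suc n) = 0" "Suc n \<le> m" for n m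
  proof -
    have "?z (Suc n) = (\<lambda>_. 0)"
      using weighted_shift_vanishes[OF b_nonneg z_nonneg z(2)] that
      by (simp add: gen_binomial_transform_eq_funpow)
    with \<open>Suc n \<le> m\<close> have "?z m = (\<lambda>_. 0)"
      by (induction m rule: dec_induct) (simp_all add: weighted_shift_def fun_eq_iff)
    then show ?thesis
      by (simp add: gen_binomial_transform_eq_funpow)
  qed
  show "no_internal_zeros_on UNIV ?y"
    unfolding no_internal_zeros_on_def
  proof (intro ballI impI)
    fix i j l
    assume ijl: "i < j \<and> j < l \<and> ?y i * ?y l \<noteq> 0"
    then have "i \<le> j" "j \<le> l"
      by simp_all
    then show "?y j \<noteq> 0"
    \<comment> \<open>Nonvanishing climbs from \<open>i\<close> to \<open>j\<close> one step at a
      time: a first zero at \<open>Suc n \<le> l\<close> would force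
      \<open>?y l = 0\<close>.\<close>
    proof (induction j rule: dec_induct)
      case (step n)
      then show ?case
        using vanish[of n l] ijl by auto
    qed (use ijl in simp)
  qed
qed

lemma gen_binomial_transform_log_convex:
  assumes b: "\<And>t. t \<le> k \<Longrightarrow> 0 \<le> b t" and x: "log_convex_on UNIV x"
  shows "log_convex_on UNIV (gen_binomial_transform b k x)"
proof -
  have z: "log_convex_on UNIV ((weighted_shift b k ^^ n) x)" for n
    by (rule funpow_weighted_shift_log_convex[OF b x])
  then have "0 \<le> (weighted_shift b k ^^ n) x m" for n m
    by (simp add: log_convex_UNIV_iff)
  then show ?thesis
    using weighted_shift_turan_log_convex[OF b z]
    by (simp add: log_convex_UNIV_iff gen_binomial_transform_eq_funpow)
qed

theorem theorem1p2:
  fixes k :: nat and b :: "nat \<Rightarrow> real"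
  assumes "k > 0"
    and "log_concave_on {0..k} b"
    and "no_internal_zeros_on {0..k} b"
  shows "(\<forall>x. log_concave_on UNIV x \<and> no_internal_zeros_on UNIV x \<longrightarrow>
            log_concave_on UNIV (gen_binomial_transform b k x) \<and>
            no_internal_zeros_on UNIV (gen_binomial_transform b k x)) \<and>
         (\<forall>x. log_convex_on UNIV x \<and> no_internal_zeros_on UNIV x \<longrightarrow>
            log_convex_on UNIV (gen_binomial_transform b k x) \<and>
            no_internal_zeros_on UNIV (gen_binomial_transform b k x))"
proof -
  have "0 \<le> b t" if "t \<le> k" for t
    using assms(2) that by (simp add: log_concave_on_def nonneg_on_def)
  then have "log_convex_on UNIV (gen_binomial_transform b k x)" if "log_convex_on UNIV x" for x
    using that by (rule gen_binomial_transform_log_convex)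
  then show ?thesis
    using gen_binomial_transform_log_concave[OF assms(2,3)] log_convex_imp_no_internal_zeros
    by blast
qed

end
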